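(* Let $D\geq 0$, let $r_0,r_1\in\mathbb{C}^\times$, let $\rho\in\{r_0,r_0^{-1}\}$, $\sigma\in\{r_1,r_1^{-1}\}$, and let $c=(c_0,\dots,c_{D-1})$, $s=(s_0,\dots,s_{D-1})$, $\lambda=(\lambda_0,\dots,\lambda_{D-1})$, $\mu=(\mu_0,\dots,\mu_{D-1})$ be tuples of nonzero complex scalars. Assume that $\lambda_0,\dots,\lambda_{D-1}$ are mutually distinct and $\lambda_i\notin\{r_0,r_0^{-1}\}$ for $0\leq i\leq D-1$, and that $\mu_0,\dots,\mu_{D-1}$ are mutually distinct. Then the $\widetilde{\mathcal H}$-module $O_D=O_D(\rho,\sigma;c,s,\lambda,\mu)$ is multiplicity-free and irreducible.
   Context: For nonzero $r_0,r_1\in\mathbb{C}$, $\widetilde{\mathcal H}=\widetilde{\mathcal H}(r_0,r_1)$ is the unital associative $\mathbb{C}$-algebra generated by $t_0,u_0,t_1,u_1$ subject to the relations (i) $(t_i-r_i)(t_i-r_i^{-1})=0$ for $i\in\{0,1\}$; (ii) $u_0^2=u_0$; (iii) $u_1^2=0$; (iv) $u_0t_0t_1u_1=0=t_1u_1u_0t_0$. Set $A=u_0t_0$ and $B=t_1u_1$. For a finite-dimensional $\widetilde{\mathcal H}$-module $V$ and $\alpha,\beta\in\mathbb{C}$ let $V_{\alpha,\beta}=\{v\in V: Av=\alpha v,\ Bv=\beta v\}$. $V$ is multiplicity-free if $A$ and $B$ are diagonalizable on $V$ and every nonzero $V_{\alpha,\beta}$ is one-dimensional. A module is irreducible if it has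 no nonzero proper submodule. For $c,r,s,\lambda,\mu\in\mathbb{C}^{\times}$ put $k(r)=r+r^{-1}$ and $$R(r,\lambda,c)=\begin{pmatrix}k(r)-\lambda^{-1}&-c\lambda^{-1}\\ c^{-1}(\lambda-k(r)+\lambda^{-1})&\lambda^{-1}\end{pmatrix},\quad P(c)=\begin{pmatrix}1&c\\0&0\end{pmatrix},$$ $$S(r,s)=\begin{pmatrix}k(r)&s\\-s^{-1}&0\end{pmatrix},\quad N(s,\mu)=\begin{pmatrix}0&0\\ s^{-1}\mu&0\end{pmatrix}.$$ Matrices act on coordinate column vectors. $O_D(\rho,\sigma;c,s,\lambda,\mu)$ is the $(2D+1)$-dimensional $\widetilde{\mathcal H}$-module with ordered basis $a_0,b_0,a_1,b_1,\dots,a_{D-1},b_{D-1},a_D$ (just $a_0$ if $D=0$) on which $t_0,u_0,t_1,u_1$ are represented respectively by $\operatorname{blockdiag}(R_0,\dots,R_{D-1},[\rho])$, $\operatorname{blockdiag}(P_0,\dots,P_{D-1},[1])$, $\operatorname{blockdiag}([\sigma],S_0,\dots,S_{D-1})$, $\operatorname{blockdiag}([0],N_0,\dots,N_{D-1})$, where $R_i=R(r_0,\lambda_i,c_i)$, $P_i=P(c_i)$, $S_i=S(r_1,s_i)$, $N_i=N(s_i,\mu_i)$ for $0\le i\le D-1$. When $D=0$ all tuples are empty and the matrices are $[\rho],[1],[\sigma],[0]$. *)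

theory Defs
  imports
    "Jordan_Normal_Form.VS_Connect"
    "HOL-Algebra.QuotRing"
    "HOL-Library.Poly_Mapping"
begin

text \<open>Words form a free monoid, written additively because this is what the ring structure on
  \<^typ>\<open>'a \<Rightarrow>\<^sub>0 'b\<close> expects. With it, \<open>gen list \<Rightarrow>\<^sub>0 complex\<close> is the free
  unital associative complex algebra on the type of generators.\<close>

instantiation list :: (type) monoid_add
begin
definition zero_list :: "'a list" where "zero_list = []"
definition plus_list :: "'a list \<Rightarrow> 'a list \<Rightarrow> 'a list" where "plus_list = (@)"
instance by standard (simp_all add: zero_list_def plus_list_def)
end

datatype gen = T0 | U0 | T1 | U1

type_synonym free_alg = "gen list \<Rightarrow>\<^sub>0 complex"

definition gvar :: "gen \<Rightarrow> free_alg" where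
  "gvar g = Poly_Mapping.single [g] 1"

definition alg_const :: "complex \<Rightarrow> free_alg" where
  "alg_const z = Poly_Mapping.single [] z"

definition relators :: "complex \<Rightarrow> complex \<Rightarrow> free_alg set" where
  "relators r0 r1 =
    {(gvar T0 - alg_const r0) * (gvar T0 - alg_const (inverse r0)),
     (gvar T1 - alg_const r1) * (gvar T1 - alg_const (inverse r1)),
     gvar U0 * gvar U0 - gvar U0,
     gvar U1 * gvar U1,
     gvar U0 * gvar T0 * gvar T1 * gvar U1,
     gvar T1 * gvar U1 * gvar U0 * gvar T0}"

text \<open>\<^const>\<open>genideal\<close> generates a two-sided ideal.\<close>

definition rel_ideal :: "complex \<Rightarrow> complex \<Rightarrow> free_alg set" where
  "rel_ideal r0 r1 = genideal class_ring (relators r0 r1)"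

definition Ht :: "complex \<Rightarrow> complex \<Rightarrow> free_alg set ring" where
  "Ht r0 r1 = class_ring Quot (rel_ideal r0 r1)"

definition Ht_class :: "complex \<Rightarrow> complex \<Rightarrow> free_alg \<Rightarrow> free_alg set" where
  "Ht_class r0 r1 p = rel_ideal r0 r1 +>\<^bsub>class_ring\<^esub> p"

definition Ht_gen :: "complex \<Rightarrow> complex \<Rightarrow> gen \<Rightarrow> free_alg set" where
  "Ht_gen r0 r1 g = Ht_class r0 r1 (gvar g)"

definition Ht_A :: "complex \<Rightarrow> complex \<Rightarrow> free_alg set" where
  "Ht_A r0 r1 = Ht_gen r0 r1 U0 \<otimes>\<^bsub>Ht r0 r1\<^esub> Ht_gen r0 r1 T0"

definition Ht_B :: "complex \<Rightarrow> complex \<Rightarrow> free_alg set" where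
  "Ht_B r0 r1 = Ht_gen r0 r1 T1 \<otimes>\<^bsub>Ht r0 r1\<^esub> Ht_gen r0 r1 U1"

text \<open>A module is a complex vector space with an action of \<^const>\<open>Ht\<close>. The axiom
  \<open>act_scalar\<close> says that the scalar multiplication is the one induced by the action.\<close>

locale fd_Ht_module =
  vectorspace "class_ring :: complex ring" V
  for V :: "(complex, 'v) module" +
  fixes r0 r1 :: complex
    and act :: "free_alg set \<Rightarrow> 'v \<Rightarrow> 'v"
  assumes fin_dim: "fin_dim"
    and act_closed: "\<lbrakk>x \<in> carrier (Ht r0 r1); v \<in> carrier V\<rbrakk> \<Longrightarrow> act x v \<in> carrier V"
    and act_add_right: "\<lbrakk>x \<in> carrier (Ht r0 r1); v \<in> carrier V; w \<in> carrier V\<rbrakk>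
      \<Longrightarrow> act x (v \<oplus>\<^bsub>V\<^esub> w) = act x v \<oplus>\<^bsub>V\<^esub> act x w"
    and act_add_left: "\<lbrakk>x \<in> carrier (Ht r0 r1); y \<in> carrier (Ht r0 r1); v \<in> carrier V\<rbrakk>
      \<Longrightarrow> act (x \<oplus>\<^bsub>Ht r0 r1\<^esub> y) v = act x v \<oplus>\<^bsub>V\<^esub> act y v"
    and act_mult: "\<lbrakk>x \<in> carrier (Ht r0 r1); y \<in> carrier (Ht r0 r1); v \<in> carrier V\<rbrakk>
      \<Longrightarrow> act (x \<otimes>\<^bsub>Ht r0 r1\<^esub> y) v = act x (act y v)"
    and act_one: "v \<in> carrier V \<Longrightarrow> act \<one>\<^bsub>Ht r0 r1\<^esub> v = v"
    and act_scalar: "v \<in> carrier V \<Longrightarrow> act (Ht_class r0 r1 (alg_const z)) v = z \<odot>\<^bsub>V\<^esub> v"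

definition diagonalizable_on :: "(complex, 'v) module \<Rightarrow> ('v \<Rightarrow> 'v) \<Rightarrow> bool" where
  "diagonalizable_on V f \<longleftrightarrow>
    (\<exists>E. vectorspace.basis class_ring V E \<and> (\<forall>v\<in>E. \<exists>z. f v = z \<odot>\<^bsub>V\<^esub> v))"

definition joint_eigenspace ::
  "complex \<Rightarrow> complex \<Rightarrow> (complex, 'v) module \<Rightarrow> (free_alg set \<Rightarrow> 'v \<Rightarrow> 'v)
    \<Rightarrow> complex \<Rightarrow> complex \<Rightarrow> 'v set" where
  "joint_eigenspace r0 r1 V act \<alpha> \<beta> =
    {v \<in> carrier V. act (Ht_A r0 r1) v = \<alpha> \<odot>\<^bsub>V\<^esub> v \<and> act (Ht_B r0 r1) v = \<beta> \<odot>\<^bsub>V\<^esub> v}"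

definition multiplicity_free ::
  "complex \<Rightarrow> complex \<Rightarrow> (complex, 'v) module \<Rightarrow> (free_alg set \<Rightarrow> 'v \<Rightarrow> 'v) \<Rightarrow> bool" where
  "multiplicity_free r0 r1 V act \<longleftrightarrow>
    diagonalizable_on V (act (Ht_A r0 r1)) \<and>
    diagonalizable_on V (act (Ht_B r0 r1)) \<and>
    (\<forall>\<alpha> \<beta>. joint_eigenspace r0 r1 V act \<alpha> \<beta> \<noteq> {\<zero>\<^bsub>V\<^esub>} \<longrightarrow>
      vectorspace.dim class_ring (V\<lparr>carrier := joint_eigenspace r0 r1 V act \<alpha> \<beta>\<rparr>) = 1)"

definition Ht_submodule ::
  "complex \<Rightarrow> complex \<Rightarrow> (complex, 'v) module \<Rightarrow> (free_alg set \<Rightarrow> 'v \<Rightarrow> 'v)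
    \<Rightarrow> 'v set \<Rightarrow> bool" where
  "Ht_submodule r0 r1 V act W \<longleftrightarrow>
    subspace class_ring W V \<and> (\<forall>x\<in>carrier (Ht r0 r1). \<forall>w\<in>W. act x w \<in> W)"

definition irreducible_module ::
  "complex \<Rightarrow> complex \<Rightarrow> (complex, 'v) module \<Rightarrow> (free_alg set \<Rightarrow> 'v \<Rightarrow> 'v) \<Rightarrow> bool" where
  "irreducible_module r0 r1 V act \<longleftrightarrow>
    \<not> (\<exists>W. Ht_submodule r0 r1 V act W \<and> W \<noteq> {\<zero>\<^bsub>V\<^esub>} \<and> W \<noteq> carrier V)"

definition word_mat :: "nat \<Rightarrow> (gen \<Rightarrow> complex mat) \<Rightarrow> gen list \<Rightarrow> complex mat" where
  "word_mat n M w = foldr (\<lambda>g X. M g * X) w (1\<^sub>m n)"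

definition eval_mat :: "nat \<Rightarrow> (gen \<Rightarrow> complex mat) \<Rightarrow> free_alg \<Rightarrow> complex mat" where
  "eval_mat n M p =
    mat n n (\<lambda>ij. \<Sum>w\<in>Poly_Mapping.keys p. Poly_Mapping.lookup p w * word_mat n M w $$ ij)"

text \<open>If the matrices \<open>M g\<close> satisfy the defining relations, \<^const>\<open>eval_mat\<close> is constant on
  each coset of \<^const>\<open>rel_ideal\<close>, and a coset acts by this common value.\<close>

definition matrix_action ::
  "nat \<Rightarrow> (gen \<Rightarrow> complex mat) \<Rightarrow> free_alg set \<Rightarrow> complex vec \<Rightarrow> complex vec" where
  "matrix_action n M x v = the_elem (eval_mat n M ` x) *\<^sub>v v"

definition k_sum :: "complex \<Rightarrow> complex" where
  "k_sum r = r + inverse r"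

definition R_mat :: "complex \<Rightarrow> complex \<Rightarrow> complex \<Rightarrow> complex mat" where
  "R_mat r l c = mat_of_rows_list 2
    [[k_sum r - inverse l, - c * inverse l],
     [inverse c * (l - k_sum r + inverse l), inverse l]]"

definition P_mat :: "complex \<Rightarrow> complex mat" where
  "P_mat c = mat_of_rows_list 2 [[1, c], [0, 0]]"

definition S_mat :: "complex \<Rightarrow> complex \<Rightarrow> complex mat" where
  "S_mat r s = mat_of_rows_list 2 [[k_sum r, s], [- inverse s, 0]]"

definition N_mat :: "complex \<Rightarrow> complex \<Rightarrow> complex mat" where
  "N_mat s m = mat_of_rows_list 2 [[0, 0], [inverse s * m, 0]]"

definition scalar_mat :: "complex \<Rightarrow> complex mat" where
  "scalar_mat z = mat_of_rows_list 1 [[z]]"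

text \<open>The tuples are sequences of which only the entries with index below \<open>D\<close> are used.\<close>

fun O_mat :: "complex \<Rightarrow> complex \<Rightarrow> nat \<Rightarrow> complex \<Rightarrow> complex
    \<Rightarrow> (nat \<Rightarrow> complex) \<Rightarrow> (nat \<Rightarrow> complex) \<Rightarrow> (nat \<Rightarrow> complex) \<Rightarrow> (nat \<Rightarrow> complex)
    \<Rightarrow> gen \<Rightarrow> complex mat" where
  "O_mat r0 r1 D \<rho> \<sigma> c s l m T0 =
    diag_block_mat (map (\<lambda>i. R_mat r0 (l i) (c i)) [0..<D] @ [scalar_mat \<rho>])"
| "O_mat r0 r1 D \<rho> \<sigma> c s l m U0 =
    diag_block_mat (map (\<lambda>i. P_mat (c i)) [0..<D] @ [scalar_mat 1])"
| "O_mat r0 r1 D \<rho> \<sigma> c s l m T1 =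
    diag_block_mat (scalar_mat \<sigma> # map (\<lambda>i. S_mat r1 (s i)) [0..<D])"
| "O_mat r0 r1 D \<rho> \<sigma> c s l m U1 =
    diag_block_mat (scalar_mat 0 # map (\<lambda>i. N_mat (s i) (m i)) [0..<D])"

definition O_space :: "nat \<Rightarrow> (complex, complex vec) module" where
  "O_space D = module_vec TYPE(complex) (2 * D + 1)"

definition O_act :: "complex \<Rightarrow> complex \<Rightarrow> nat \<Rightarrow> complex \<Rightarrow> complex
    \<Rightarrow> (nat \<Rightarrow> complex) \<Rightarrow> (nat \<Rightarrow> complex) \<Rightarrow> (nat \<Rightarrow> complex) \<Rightarrow> (nat \<Rightarrow> complex)
    \<Rightarrow> free_alg set \<Rightarrow> complex vec \<Rightarrow> complex vec" where
  "O_act r0 r1 D \<rho> \<sigma> c s l m = matrix_action (2 * D + 1) (O_mat r0 r1 D \<rho> \<sigma> c s l m)"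

end

theory Submission
  imports Defs
begin

text \<open>
  The operators \<open>A = u\<^sub>0 t\<^sub>0\<close> and \<open>B = t\<^sub>1 u\<^sub>1\<close> turn out to be diagonal in the given basis: blockwise,
  \<open>P R\<close> has the single nonzero entry \<open>\<lambda>\<^sub>i\<close> at the position of \<open>a\<^sub>i\<close>, and \<open>S N\<close> the single nonzero entry
  \<open>\<mu>\<^sub>i\<close> at the position of \<open>b\<^sub>i\<close> (\<open>P_R_mat\<close>, \<open>S_N_mat\<close>). The basis vectors \<open>a\<^sub>i\<close>, \<open>b\<^sub>i\<close> and \<open>a\<^sub>D\<close>
  therefore have the weights \<open>(\<lambda>\<^sub>i, 0)\<close>, \<open>(0, \<mu>\<^sub>i)\<close> and \<open>(\<rho>, 0)\<close>. These are pairwise distinct because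
  the \<open>\<lambda>\<^sub>i\<close> are distinct and differ from \<open>\<rho>\<close>, and the \<open>\<mu>\<^sub>i\<close> are distinct and nonzero. Hence every
  nonzero joint eigenspace is a coordinate line, which is \<open>multiplicity_free\<close>. It also follows that
  \<open>A B = 0 = B A\<close>; the other relations hold block by block, so the matrices
  define a module (\<open>fd_Ht_module\<close>).

  For irreducibility, since distinct weights can be separated, a submodule contains the basis vector
  \<open>e\<^sub>k\<close> as soon as one of its elements has a nonzero coordinate at \<open>k\<close>
  (\<open>unit_vec_mem_submodule\<close>). So a nonzero submodule contains some basis vector, and from a basis
  vector one reaches all others if consecutive ones are linked in both directions by nonzero matrix
  entries of the generators (\<open>irreducible\<close>). Within the pairs \<open>a\<^sub>i, b\<^sub>i\<close> the link is \<open>t\<^sub>0\<close>, where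
  the entry from \<open>a\<^sub>i\<close> to \<open>b\<^sub>i\<close> is a nonzero multiple of
  \<open>\<lambda> - r - r\<^sup>-\<^sup>1 + \<lambda>\<^sup>-\<^sup>1 = (\<lambda> - r) (\<lambda> - r\<^sup>-\<^sup>1) / \<lambda>\<close> with \<open>r = r\<^sub>0\<close>, and within the pairs
  \<open>b\<^sub>i, a\<^sub>i\<^sub>+\<^sub>1\<close> the link is \<open>t\<^sub>1\<close>.
\<close>

section \<open>Block diagonal matrices\<close>

lemma square_matE:
  assumes "square_mat A"
  obtains n where "A \<in> carrier_mat n n"
  using assms by (intro that[of "dim_row A"] carrier_matI) simp_all

lemma diag_block_mat_carrier:
  assumes "\<forall>A \<in> set As. square_mat A"
  shows "diag_block_mat As \<in> carrier_mat (sum_list (map dim_row As)) (sum_list (map dim_row As))"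
proof -
  have "square_mat (diag_block_mat As)"
    using assms by (intro diag_block_mat_square) blast
  thus ?thesis by (intro carrier_matI) (simp_all only: square_mat.simps dim_diag_block_mat)
qed

lemma diag_block_mat_mult:
  assumes "\<forall>x \<in> set xs. \<exists>n. f x \<in> carrier_mat n n \<and> g x \<in> carrier_mat n n"
  shows "diag_block_mat (map f xs) * diag_block_mat (map g xs) = diag_block_mat (map (\<lambda>x. f x * g x) xs)"
  using assms
proof (induction xs)
  case (Cons x xs)
  obtain n where n: "f x \<in> carrier_mat n n" "g x \<in> carrier_mat n n"
    using Cons.prems by auto
  have *: "\<forall>x \<in> set xs. \<exists>n. f x \<in> carrier_mat n n \<and> g x \<in> carrier_mat n n"
    using Cons.prems by simp
  define m where "m = sum_list (map dim_row (map f xs))"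
  have rows: "map dim_row (map g xs) = map dim_row (map f xs)"
    "map dim_row (map (\<lambda>x. f x * g x) xs) = map dim_row (map f xs)"
    and sq: "\<forall>X \<in> set (map f xs). square_mat X" "\<forall>X \<in> set (map g xs). square_mat X"
      "\<forall>X \<in> set (map (\<lambda>x. f x * g x) xs). square_mat X"
    using * by fastforce+
  have m: "diag_block_mat (map f xs) \<in> carrier_mat m m" "diag_block_mat (map g xs) \<in> carrier_mat m m"
    "diag_block_mat (map (\<lambda>x. f x * g x) xs) \<in> carrier_mat m m"
    using sq[THEN diag_block_mat_carrier, unfolded rows] unfolding m_def by simp_all
  show ?case
    unfolding diag_block_mat.simps Let_def list.map
    by (subst mult_four_block_mat[of _ n n _ m _ m _ _ n _ m])
      (use n m Cons.IH[OF *] in auto)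
qed simp

lemma diag_block_mat_minus_scalar:
  fixes z :: "'a :: ring_1"
  assumes "\<forall>A \<in> set As. square_mat A"
  shows "diag_block_mat As - z \<cdot>\<^sub>m 1\<^sub>m (sum_list (map dim_row As)) =
    diag_block_mat (map (\<lambda>A. A - z \<cdot>\<^sub>m 1\<^sub>m (dim_row A)) As)"
  using assms
proof (induction As)
  case (Cons A As)
  have "square_mat A" using Cons.prems by auto
  then obtain n where n: "A \<in> carrier_mat n n" by (rule square_matE)
  define m where "m = sum_list (map dim_row As)"
  have m: "diag_block_mat As \<in> carrier_mat m m"
    using diag_block_mat_carrier[of As] Cons.prems unfolding m_def by simp
  have IH: "diag_block_mat (map (\<lambda>A. A - z \<cdot>\<^sub>m 1\<^sub>m (dim_row A)) As) = diag_block_mat As - z \<cdot>\<^sub>m 1\<^sub>m m"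
    using Cons unfolding m_def by simp
  show ?case
    unfolding diag_block_mat.simps Let_def list.map IH sum_list.Cons m_def[symmetric]
    by (rule eq_matI) (use n m in \<open>auto simp: not_less\<close>)
qed auto

lemma diag_block_mat_zero:
  assumes "\<forall>A \<in> set As. A = 0\<^sub>m (dim_row A) (dim_row A)"
  shows "diag_block_mat As = 0\<^sub>m (sum_list (map dim_row As)) (sum_list (map dim_row As))"
  using assms
proof (induction As)
  case (Cons A As)
  obtain n where n: "A = 0\<^sub>m n n" using Cons.prems by auto
  have "diag_block_mat As = 0\<^sub>m (sum_list (map dim_row As)) (sum_list (map dim_row As))"
    using Cons by simp
  then show ?case
    unfolding diag_block_mat.simps Let_def n by (intro eq_matI) auto
qed auto

lemma diag_block_mat_diagonal:
  assumes "\<forall>A \<in> set As. square_mat A \<and> diagonal_mat A"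
  shows "diagonal_mat (diag_block_mat As)"
  using assms
proof (induction As)
  case (Cons A As)
  have "square_mat A" using Cons.prems by auto
  then obtain n where n: "A \<in> carrier_mat n n" by (rule square_matE)
  define m where "m = sum_list (map dim_row As)"
  have m: "diag_block_mat As \<in> carrier_mat m m"
    using diag_block_mat_carrier[of As] Cons.prems unfolding m_def by simp
  have "diagonal_mat A" "diagonal_mat (diag_block_mat As)" using Cons by auto
  thus ?case
    using n m unfolding diagonal_mat_def by (auto simp: Let_def)
qed (auto simp: diagonal_mat_def)

text \<open>The sum of the row numbers of the preceding blocks is the offset at which a block starts.\<close>

lemma diag_block_mat_index:
  assumes "\<forall>A \<in> set As. square_mat A" and "i < length As"
    and "p < dim_row (As ! i)" and "q < dim_row (As ! i)"
  shows "diag_block_mat As $$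
    (sum_list (map dim_row (take i As)) + p, sum_list (map dim_row (take i As)) + q) = As ! i $$ (p, q)"
  using assms
proof (induction As arbitrary: i)
  case (Cons A As)
  have "square_mat A" using Cons.prems by auto
  then obtain n where n: "A \<in> carrier_mat n n" by (rule square_matE)
  define m where "m = sum_list (map dim_row As)"
  have m: "diag_block_mat As \<in> carrier_mat m m"
    using diag_block_mat_carrier[of As] Cons.prems unfolding m_def by simp
  show ?case
  proof (cases i)
    case 0
    with Cons.prems n m show ?thesis by (auto simp: Let_def)
  next
    case (Suc j)
    have "sum_list (map dim_row (take j As)) + dim_row (As ! j) =
      sum_list (map dim_row (take (Suc j) As))"
      using Cons.prems Suc by (simp add: take_Suc_conv_app_nth)
    also have "\<dots> \<le> sum_list (map dim_row (take (Suc j) As)) + sum_list (map dim_row (drop (Suc j) As))"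
      by simp
    also have "\<dots> = m"
      unfolding m_def by (metis append_take_drop_id map_append sum_list_append)
    finally have le: "sum_list (map dim_row (take j As)) + dim_row (As ! j) \<le> m" .
    have "diag_block_mat As $$ (sum_list (map dim_row (take j As)) + p,
      sum_list (map dim_row (take j As)) + q) = As ! j $$ (p, q)"
      using Cons.prems Suc by (intro Cons.IH) auto
    thus ?thesis using n m le Cons.prems(3,4) Suc by (simp add: Let_def)
  qed
qed simp

section \<open>Evaluating the free algebra at matrices\<close>

lemma eval_mat_carrier [simp]: "eval_mat n M p \<in> carrier_mat n n"
  by (simp add: eval_mat_def)

lemma eval_mat_index:
  assumes "finite S" "Poly_Mapping.keys p \<subseteq> S" "i < n" "j < n"
  shows "eval_mat n M p $$ (i, j) = (\<Sum>w\<in>S. Poly_Mapping.lookup p w * word_mat n M w $$ (i, j))"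
  unfolding eval_mat_def using assms
  by (auto intro!: sum.mono_neutral_left simp: in_keys_iff)

lemma eval_mat_add: "eval_mat n M (p + q) = eval_mat n M p + eval_mat n M q"
proof (rule eq_matI)
  fix i j assume "i < dim_row (eval_mat n M p + eval_mat n M q)" "j < dim_col (eval_mat n M p + eval_mat n M q)"
  hence ij: "i < n" "j < n" "i < dim_row (eval_mat n M q)" "j < dim_col (eval_mat n M q)"
    by (auto simp: eval_mat_def)
  let ?S = "Poly_Mapping.keys p \<union> Poly_Mapping.keys q"
  have "eval_mat n M r $$ (i,j) = (\<Sum>w\<in>?S. Poly_Mapping.lookup r w * word_mat n M w $$ (i, j))"
    if "r \<in> {p, q, p + q}" for r
    using that ij keys_add[of p q] by (intro eval_mat_index) auto
  thus "eval_mat n M (p + q) $$ (i, j) = (eval_mat n M p + eval_mat n M q) $$ (i, j)"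
    using ij by (simp add: index_add_mat lookup_add sum.distrib distrib_right)
qed (auto simp: eval_mat_def)

lemma eval_mat_zero: "eval_mat n M 0 = 0\<^sub>m n n"
  by (rule eq_matI) (auto simp: eval_mat_def)

lemma eval_mat_single:
  assumes "word_mat n M w \<in> carrier_mat n n"
  shows "eval_mat n M (Poly_Mapping.single w z) = z \<cdot>\<^sub>m word_mat n M w"
  using assms by (intro eq_matI) (auto simp: eval_mat_def)

lemma eval_mat_minus: "eval_mat n M (p - q) = eval_mat n M p - eval_mat n M q"
proof -
  have "eval_mat n M p = eval_mat n M (p - q) + eval_mat n M q"
    by (simp flip: eval_mat_add)
  moreover have "X = X + Y - Y" if "X \<in> carrier_mat n n" "Y \<in> carrier_mat n n" for X Y :: "complex mat"
    using that by (intro eq_matI) auto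
  ultimately show ?thesis by simp
qed

text \<open>Multiplicativity of the evaluation is bilinear in its arguments, so this induction reduces it to
  words, where it is the concatenation law below.\<close>

lemma free_alg_induct [case_names zero single add]:
  fixes p :: free_alg
  assumes "P 0" "\<And>w z. P (Poly_Mapping.single w z)" "\<And>p q. P p \<Longrightarrow> P q \<Longrightarrow> P (p + q)"
  shows "P p"
proof (induction p rule: update_induct)
  case (update f a b)
  have "Poly_Mapping.update a b f = f + Poly_Mapping.single a b"
    using update.hyps by (intro poly_mapping_eqI)
      (auto simp: Poly_Mapping.lookup_update lookup_add lookup_single in_keys_iff when_def)
  thus ?case using update assms by simp
qed (use assms in auto)

lemma smult_smult_mat: "a \<cdot>\<^sub>m (b \<cdot>\<^sub>m A) = (a * b :: 'a :: semigroup_mult) \<cdot>\<^sub>m A"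
  by (rule eq_matI) (auto simp: mult.assoc)

lemma mat_diag_mult_vec:
  fixes v :: "'a :: comm_semiring_0 vec"
  assumes "v \<in> carrier_vec n"
  shows "mat_diag n f *\<^sub>v v = vec n (\<lambda>i. f i * v $ i)"
proof (rule eq_vecI)
  fix i assume "i < dim_vec (vec n (\<lambda>i. f i * v $ i))"
  thus "(mat_diag n f *\<^sub>v v) $ i = vec n (\<lambda>i. f i * v $ i) $ i"
    using assms by (simp add: mat_diag_def scalar_prod_def if_distrib[of "\<lambda>x. x * _"] cong: if_cong)
qed (simp add: mat_diag_def)

lemma scalar_mult_vec:
  fixes v :: "'a :: comm_ring_1 vec"
  assumes "v \<in> carrier_vec n"
  shows "(z \<cdot>\<^sub>m 1\<^sub>m n) *\<^sub>v v = z \<cdot>\<^sub>v v"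
proof -
  have "z \<cdot>\<^sub>m 1\<^sub>m n = mat_diag n (\<lambda>_. z)" by (rule eq_matI) (auto simp: mat_diag_def)
  thus ?thesis using assms by (auto simp: mat_diag_mult_vec intro!: eq_vecI)
qed

lemma smult_one_mat: "(1 :: 'a :: monoid_mult) \<cdot>\<^sub>m A = A"
  by (rule eq_matI) auto

context
  fixes n :: nat and M :: "gen \<Rightarrow> complex mat"
  assumes M [simp]: "M g \<in> carrier_mat n n"
begin

lemma word_mat_carrier [simp]: "word_mat n M w \<in> carrier_mat n n"
  unfolding word_mat_def by (induction w) (auto intro: mult_carrier_mat[OF M])

lemma word_mat_append: "word_mat n M (v @ w) = word_mat n M v * word_mat n M w"
proof (induction v)
  case (Cons g v)
  have "word_mat n M ((g # v) @ w) = M g * (word_mat n M v * word_mat n M w)"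
    using Cons by (simp add: word_mat_def)
  also have "\<dots> = M g * word_mat n M v * word_mat n M w"
    by (rule assoc_mult_mat[symmetric]) (rule M word_mat_carrier)+
  finally show ?case by (simp add: word_mat_def)
next
  case Nil
  have "word_mat n M [] = 1\<^sub>m n" by (simp add: word_mat_def)
  thus ?case using left_mult_one_mat[OF word_mat_carrier] by simp
qed

lemma eval_mat_mult: "eval_mat n M (p * q) = eval_mat n M p * eval_mat n M q"
proof (induction p rule: free_alg_induct)
  case zero
  show ?case using left_mult_zero_mat[OF eval_mat_carrier] by (simp add: eval_mat_zero)
next
  case (add p p')
  thus ?case
    by (simp add: distrib_right eval_mat_add
        add_mult_distrib_mat[OF eval_mat_carrier eval_mat_carrier eval_mat_carrier])
next
  case (single w z)
  show ?case
  proof (induction q rule: free_alg_induct)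
    case zero
    show ?case using right_mult_zero_mat[OF eval_mat_carrier] by (simp add: eval_mat_zero)
  next
    case (add q q')
    thus ?case
      by (simp add: distrib_left eval_mat_add
        mult_add_distrib_mat[OF eval_mat_carrier eval_mat_carrier eval_mat_carrier])
  next
    case (single v y)
    have "word_mat n M (w + v) = word_mat n M w * word_mat n M v"
      by (simp add: plus_list_def word_mat_append)
    moreover have "z \<cdot>\<^sub>m word_mat n M w * (y \<cdot>\<^sub>m word_mat n M v) = (z * y) \<cdot>\<^sub>m (word_mat n M w * word_mat n M v)"
      unfolding mult_smult_assoc_mat[OF word_mat_carrier smult_carrier_mat[OF word_mat_carrier]]
        mult_smult_distrib[OF word_mat_carrier word_mat_carrier] smult_smult_mat ..
    ultimately show ?case
      by (simp add: mult_single eval_mat_single[OF word_mat_carrier])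
  qed
qed

lemma eval_mat_gvar: "eval_mat n M (gvar g) = M g"
  using right_mult_one_mat[OF M]
  by (simp add: gvar_def eval_mat_single) (simp add: word_mat_def smult_one_mat)

lemma eval_mat_const: "eval_mat n M (alg_const z) = z \<cdot>\<^sub>m 1\<^sub>m n"
  by (simp add: alg_const_def eval_mat_single) (simp add: word_mat_def)

end

section \<open>The quotient algebra and its matrix representations\<close>

lemma free_alg_ring: "ring (class_ring :: free_alg ring)"
  by (rule class_ring.ring_axioms)

lemma rel_ideal_ideal: "ideal (rel_ideal r0 r1) class_ring"
  unfolding rel_ideal_def by (intro ring.genideal_ideal[OF free_alg_ring]) simp

lemma carrier_Ht_cases:
  assumes "x \<in> carrier (Ht r0 r1)"
  obtains p where "x = Ht_class r0 r1 p"
  using assms unfolding Ht_def Ht_class_def by (auto simp: FactRing_def A_RCOSETS_def')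

lemma Ht_class_carrier [simp]: "Ht_class r0 r1 p \<in> carrier (Ht r0 r1)"
  unfolding Ht_def Ht_class_def by (auto simp: FactRing_def A_RCOSETS_def')

lemma Ht_class_add: "Ht_class r0 r1 p \<oplus>\<^bsub>Ht r0 r1\<^esub> Ht_class r0 r1 q = Ht_class r0 r1 (p + q)"
  using ideal.a_rcos_sum[OF rel_ideal_ideal, of p q r0 r1]
  by (simp add: Ht_def Ht_class_def FactRing_def)

lemma Ht_class_mult: "Ht_class r0 r1 p \<otimes>\<^bsub>Ht r0 r1\<^esub> Ht_class r0 r1 q = Ht_class r0 r1 (p * q)"
  using ideal.rcoset_mult_add[OF rel_ideal_ideal, of p q r0 r1]
  by (simp add: Ht_def Ht_class_def FactRing_def)

lemma Ht_class_one: "\<one>\<^bsub>Ht r0 r1\<^esub> = Ht_class r0 r1 (alg_const 1)"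
proof -
  have "alg_const 1 = 1" by (simp add: alg_const_def zero_list_def flip: single_one)
  thus ?thesis by (simp add: Ht_def Ht_class_def FactRing_def)
qed

text \<open>The last two relations are bracketed as products of \<open>A\<close> and \<open>B\<close>, the form in which they can be
  checked on the diagonal.\<close>

locale Ht_matrices =
  fixes n :: nat and M :: "gen \<Rightarrow> complex mat" and r0 r1 :: complex
  assumes M [simp]: "M g \<in> carrier_mat n n"
    and T0_rel: "(M T0 - r0 \<cdot>\<^sub>m 1\<^sub>m n) * (M T0 - inverse r0 \<cdot>\<^sub>m 1\<^sub>m n) = 0\<^sub>m n n"
    and T1_rel: "(M T1 - r1 \<cdot>\<^sub>m 1\<^sub>m n) * (M T1 - inverse r1 \<cdot>\<^sub>m 1\<^sub>m n) = 0\<^sub>m n n"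
    and U0_rel: "M U0 * M U0 = M U0"
    and U1_rel: "M U1 * M U1 = 0\<^sub>m n n"
    and AB_rel: "(M U0 * M T0) * (M T1 * M U1) = 0\<^sub>m n n"
    and BA_rel: "(M T1 * M U1) * (M U0 * M T0) = 0\<^sub>m n n"
begin

sublocale vec_space "TYPE(complex)" n .

lemmas eval_mat_hom =
  eval_mat_add eval_mat_minus eval_mat_zero eval_mat_mult[of M n, OF M] eval_mat_gvar[of M n, OF M]
  eval_mat_const[of M n, OF M]

lemma ideal_eval_mat_kernel: "ideal {p. eval_mat n M p = 0\<^sub>m n n} class_ring"
proof (rule idealI[OF free_alg_ring])
  show "subgroup {p. eval_mat n M p = 0\<^sub>m n n} (add_monoid class_ring)"
  proof
    fix p :: free_alg assume p: "p \<in> {p. eval_mat n M p = 0\<^sub>m n n}"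
    have "a_inv class_ring p = 0 - p" by (simp add: class_ring_simps)
    hence "a_inv class_ring p \<in> {p. eval_mat n M p = 0\<^sub>m n n}"
      using p by (simp only: eval_mat_hom) (simp add: eval_mat_hom del: diff_0)
    thus "inv\<^bsub>add_monoid class_ring\<^esub> p \<in> {p. eval_mat n M p = 0\<^sub>m n n}"
      unfolding a_inv_def .
  qed (auto simp: eval_mat_hom)
next
  fix p x :: free_alg assume p: "p \<in> {p. eval_mat n M p = 0\<^sub>m n n}"
  show "x \<otimes>\<^bsub>class_ring\<^esub> p \<in> {p. eval_mat n M p = 0\<^sub>m n n}"
    using p right_mult_zero_mat[OF eval_mat_carrier[of n M x]] by (simp add: eval_mat_hom)
  show "p \<otimes>\<^bsub>class_ring\<^esub> x \<in> {p. eval_mat n M p = 0\<^sub>m n n}"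
    using p left_mult_zero_mat[OF eval_mat_carrier[of n M x]] by (simp add: eval_mat_hom)
qed

text \<open>Evaluation is an algebra homomorphism, so its kernel is an ideal, and the defining relations of
  the locale put the relators into it.\<close>

lemma rel_ideal_subset_kernel: "rel_ideal r0 r1 \<subseteq> {p. eval_mat n M p = 0\<^sub>m n n}"
  unfolding rel_ideal_def
proof (rule ring.genideal_minimal[OF free_alg_ring ideal_eval_mat_kernel])
  have c: "M U0 * M T0 \<in> carrier_mat n n" "M T1 * M U1 \<in> carrier_mat n n"
    by (auto intro: mult_carrier_mat[OF M M])
  have "M U0 * M T0 * M T1 * M U1 = 0\<^sub>m n n" "M T1 * M U1 * M U0 * M T0 = 0\<^sub>m n n"
    using assoc_mult_mat[OF c(1) M[of T1] M[of U1]] assoc_mult_mat[OF c(2) M[of U0] M[of T0]]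
    by (simp_all add: AB_rel BA_rel)
  thus "relators r0 r1 \<subseteq> {p. eval_mat n M p = 0\<^sub>m n n}"
    using minus_r_inv_mat[OF M[of U0]] unfolding relators_def
    by (auto simp: eval_mat_hom T0_rel T1_rel U0_rel U1_rel)
qed

text \<open>By the previous lemma evaluation is constant on cosets, so \<^const>\<open>the_elem\<close> in
  \<^const>\<open>matrix_action\<close> is applied to a singleton.\<close>

lemma matrix_action_class: "matrix_action n M (Ht_class r0 r1 p) v = eval_mat n M p *\<^sub>v v"
proof -
  have "eval_mat n M (h + p) = eval_mat n M p" if "h \<in> rel_ideal r0 r1" for h
    using that rel_ideal_subset_kernel by (auto simp: eval_mat_hom)
  moreover have "0 \<in> rel_ideal r0 r1"
    using additive_subgroup.zero_closed[OF ideal.axioms(1)[OF rel_ideal_ideal]] by simp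
  ultimately have "eval_mat n M ` Ht_class r0 r1 p = {eval_mat n M p}"
    unfolding Ht_class_def by (auto simp: a_r_coset_def' intro!: image_eqI[of _ _ "0 + p"])
  thus ?thesis by (simp add: matrix_action_def)
qed

lemma matrix_action_gen: "matrix_action n M (Ht_gen r0 r1 g) v = M g *\<^sub>v v"
  by (simp add: Ht_gen_def matrix_action_class eval_mat_hom)

lemma matrix_action_A: "matrix_action n M (Ht_A r0 r1) v = (M U0 * M T0) *\<^sub>v v"
  by (simp add: Ht_A_def Ht_gen_def Ht_class_mult matrix_action_class eval_mat_hom)

lemma matrix_action_B: "matrix_action n M (Ht_B r0 r1) v = (M T1 * M U1) *\<^sub>v v"
  by (simp add: Ht_B_def Ht_gen_def Ht_class_mult matrix_action_class eval_mat_hom)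

lemma fd_Ht_module: "fd_Ht_module (module_vec TYPE(complex) n) r0 r1 (matrix_action n M)"
proof (intro fd_Ht_module.intro fd_Ht_module_axioms.intro)
  let ?V = "module_vec TYPE(complex) n"
  show "vectorspace class_ring ?V" by (rule vec_vs)
  show "vectorspace.fin_dim class_ring ?V" by (rule fin_dim)
  fix x y v w z
  assume v: "v \<in> carrier ?V"
  show "matrix_action n M \<one>\<^bsub>Ht r0 r1\<^esub> v = v"
    using v by (simp add: Ht_class_one matrix_action_class eval_mat_hom smult_one_mat)
  show "matrix_action n M (Ht_class r0 r1 (alg_const z)) v = z \<odot>\<^bsub>?V\<^esub> v"
    using v by (simp add: matrix_action_class eval_mat_hom scalar_mult_vec)
  assume x: "x \<in> carrier (Ht r0 r1)"
  then obtain p where p: "x = Ht_class r0 r1 p" by (rule carrier_Ht_cases)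
  show "matrix_action n M x v \<in> carrier ?V"
    using v by (simp add: p matrix_action_class mult_mat_vec_carrier[of _ n n])
  show "matrix_action n M x (v \<oplus>\<^bsub>?V\<^esub> w) = matrix_action n M x v \<oplus>\<^bsub>?V\<^esub> matrix_action n M x w"
    if "w \<in> carrier ?V"
    using v that by (simp add: p matrix_action_class mult_add_distrib_mat_vec[of _ n n])
  assume y: "y \<in> carrier (Ht r0 r1)"
  then obtain q where q: "y = Ht_class r0 r1 q" by (rule carrier_Ht_cases)
  show "matrix_action n M (x \<oplus>\<^bsub>Ht r0 r1\<^esub> y) v = matrix_action n M x v \<oplus>\<^bsub>?V\<^esub> matrix_action n M y v"
    using v by (simp add: p q Ht_class_add matrix_action_class eval_mat_hom add_mult_distrib_mat_vec[of _ n n])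
  show "matrix_action n M (x \<otimes>\<^bsub>Ht r0 r1\<^esub> y) v = matrix_action n M x (matrix_action n M y v)"
    using v by (simp add: p q Ht_class_mult matrix_action_class eval_mat_hom assoc_mult_mat_vec[of _ n n _ n])
qed

end


section \<open>Diagonal weight operators with distinct weights\<close>

locale weight_matrices = Ht_matrices +
  fixes \<alpha> \<beta> :: "nat \<Rightarrow> complex"
  assumes A_diag: "M U0 * M T0 = mat_diag n \<alpha>"
    and B_diag: "M T1 * M U1 = mat_diag n \<beta>"
    and weights_inj: "inj_on (\<lambda>i. (\<alpha> i, \<beta> i)) {..<n}"
begin

lemma action_A:
  assumes "v \<in> carrier_vec n"
  shows "matrix_action n M (Ht_A r0 r1) v = vec n (\<lambda>i. \<alpha> i * v $ i)"
  using assms by (simp add: matrix_action_A A_diag mat_diag_mult_vec)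

lemma action_B:
  assumes "v \<in> carrier_vec n"
  shows "matrix_action n M (Ht_B r0 r1) v = vec n (\<lambda>i. \<beta> i * v $ i)"
  using assms by (simp add: matrix_action_B B_diag mat_diag_mult_vec)

lemma vec_eq_smult_iff:
  fixes v :: "complex vec"
  assumes "v \<in> carrier_vec n"
  shows "vec n (\<lambda>i. f i * v $ i) = z \<cdot>\<^sub>v v \<longleftrightarrow> (\<forall>i<n. v $ i \<noteq> 0 \<longrightarrow> f i = z)"
  using assms by (auto simp: vec_eq_iff)

lemma diagonalizable_on_diagonal:
  fixes f :: "complex vec \<Rightarrow> complex vec"
  assumes "\<And>v. v \<in> carrier_vec n \<Longrightarrow> f v = vec n (\<lambda>i. g i * v $ i)"
  shows "diagonalizable_on V f"
  unfolding diagonalizable_on_def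
proof (intro exI[of _ "set (unit_vecs n)"] conjI ballI)
  fix v :: "complex vec" assume "v \<in> set (unit_vecs n)"
  then obtain k where "k < n" "v = unit_vec n k" unfolding unit_vecs_def by auto
  thus "\<exists>z. f v = z \<odot>\<^bsub>V\<^esub> v"
    using assms[of v] by (intro exI[of _ "g k"]) (auto simp: vec_eq_iff)
qed (rule unit_vecs_basis)

lemma joint_eigenspace_iff:
  "v \<in> joint_eigenspace r0 r1 V (matrix_action n M) a b \<longleftrightarrow>
    v \<in> carrier_vec n \<and> (\<forall>i<n. v $ i \<noteq> 0 \<longrightarrow> (\<alpha> i, \<beta> i) = (a, b))"
  by (auto simp: joint_eigenspace_def action_A action_B vec_eq_smult_iff)

lemma multiplicity_free: "multiplicity_free r0 r1 V (matrix_action n M)"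
  unfolding multiplicity_free_def
proof (intro conjI allI impI)
  show "diagonalizable_on V (matrix_action n M (Ht_A r0 r1))"
    by (rule diagonalizable_on_diagonal[OF action_A])
  show "diagonalizable_on V (matrix_action n M (Ht_B r0 r1))"
    by (rule diagonalizable_on_diagonal[OF action_B])
next
  fix a b
  define J where "J = joint_eigenspace r0 r1 V (matrix_action n M) a b"
  assume "joint_eigenspace r0 r1 V (matrix_action n M) a b \<noteq> {\<zero>\<^bsub>V\<^esub>}"
  moreover have "0\<^sub>v n \<in> J" by (simp add: J_def joint_eigenspace_iff)
  ultimately obtain v where v: "v \<in> J" "v \<noteq> 0\<^sub>v n" unfolding J_def[symmetric] by auto
  hence "v \<in> carrier_vec n" by (simp add: J_def joint_eigenspace_iff)
  with v obtain k where k: "k < n" "v $ k \<noteq> 0" by (auto simp: vec_eq_iff)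
  hence k_weight: "(\<alpha> k, \<beta> k) = (a, b)" using v by (simp add: J_def joint_eigenspace_iff)
  let ?e = "unit_vec n k :: complex vec"
  have J: "J = {z \<cdot>\<^sub>v ?e | z. True}"
  proof (intro equalityI subsetI)
    fix w assume w: "w \<in> J"
    hence "w $ i = 0" if "i < n" "i \<noteq> k" for i
      using that k_weight k(1) inj_onD[OF weights_inj, of i k] by (auto simp: J_def joint_eigenspace_iff)
    hence "w = w $ k \<cdot>\<^sub>v ?e"
      using w k(1) by (auto simp: J_def joint_eigenspace_iff vec_eq_iff)
    thus "w \<in> {z \<cdot>\<^sub>v ?e | z. True}" by blast
  qed (use k_weight k(1) in \<open>auto simp: J_def joint_eigenspace_iff split: if_splits\<close>)
  have span: "span {?e} = J"
  proof -
    have "lincomb c {?e} = c ?e \<cdot>\<^sub>v ?e" for c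
      by (simp add: lincomb_def)
    hence "span {?e} = {c ?e \<cdot>\<^sub>v ?e | c. True}"
      by (subst finite_span) auto
    also have "\<dots> = J" unfolding J by (auto intro: exI[of _ "\<lambda>_. z" for z])
    finally show ?thesis .
  qed
  hence sub: "subspace class_ring J V"
    using span_is_subspace[of "{?e}"] by simp
  have e: "?e \<in> J" using in_own_span[of "{?e}"] span by simp
  show "vectorspace.dim class_ring (vs J) = 1"
  proof (rule vectorspace.dim1I[OF subspace_is_vs[OF sub], of ?e])
    show "?e \<noteq> \<zero>\<^bsub>vs J\<^esub>" "?e \<in> carrier (vs J)" using e k(1) by simp_all
  qed (use e span span_li_not_depend(1)[OF _ is_module[OF sub], of "{?e}"] in simp)
qed

text \<open>A weight separation argument by induction on the size of the support. If \<open>w\<close> is supported at some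
  \<open>j \<noteq> k\<close>, one of the weight operators, with eigenvalues \<open>f\<close>, satisfies \<open>f j \<noteq> f k\<close>. Subtracting
  \<open>f j\<close> times \<open>w\<close> from its image of \<open>w\<close> removes the coordinate \<open>j\<close>, creates no new ones, and scales
  the coordinate \<open>k\<close> by \<open>f k - f j \<noteq> 0\<close>.\<close>

lemma unit_vec_mem_submodule:
  assumes "Ht_submodule r0 r1 V (matrix_action n M) W" and "w \<in> W" and "k < n" and "w $ k \<noteq> 0"
  shows "unit_vec n k \<in> W"
  using assms(2,4)
proof (induction "card {i. i < n \<and> w $ i \<noteq> 0}" arbitrary: w rule: less_induct)
  case less
  have W: "W \<subseteq> carrier_vec n" "\<And>x y. x \<in> W \<Longrightarrow> y \<in> W \<Longrightarrow> x + y \<in> W" "\<And>z x. x \<in> W \<Longrightarrow> z \<cdot>\<^sub>v x \<in> W"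
    and act: "\<And>x u. x \<in> carrier (Ht r0 r1) \<Longrightarrow> u \<in> W \<Longrightarrow> matrix_action n M x u \<in> W"
    using assms(1) unfolding Ht_submodule_def subspace_def submodule_def by auto
  have w: "w \<in> carrier_vec n" using W less.prems by blast
  show ?case
  proof (cases "\<exists>j<n. j \<noteq> k \<and> w $ j \<noteq> 0")
    case True
    then obtain j where j: "j < n" "j \<noteq> k" "w $ j \<noteq> 0" by blast
    have "\<exists>f. f j \<noteq> f k \<and> vec n (\<lambda>i. f i * w $ i) \<in> W"
    proof (cases "\<alpha> j = \<alpha> k")
      case True
      hence "\<beta> j \<noteq> \<beta> k" using inj_onD[OF weights_inj, of j k] j assms(3) by auto
      moreover have "matrix_action n M (Ht_B r0 r1) w \<in> W"
        using less.prems by (intro act) (simp_all add: Ht_B_def Ht_gen_def Ht_class_mult)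
      ultimately show ?thesis using w by (auto simp: action_B)
    next
      case False
      moreover have "matrix_action n M (Ht_A r0 r1) w \<in> W"
        using less.prems by (intro act) (simp_all add: Ht_A_def Ht_gen_def Ht_class_mult)
      ultimately show ?thesis using w by (auto simp: action_A)
    qed
    then obtain f where f: "f j \<noteq> f k" "vec n (\<lambda>i. f i * w $ i) \<in> W" by blast
    define w' where "w' = vec n (\<lambda>i. f i * w $ i) + (- f j) \<cdot>\<^sub>v w"
    have w'_index: "w' $ i = (f i - f j) * w $ i" if "i < n" for i
      using that w by (simp add: w'_def algebra_simps)
    show ?thesis
    proof (rule less.hyps)
      show "w' \<in> W" unfolding w'_def using f W less.prems by blast
      show "w' $ k \<noteq> 0" using f less.prems assms(3) by (simp add: w'_index)
      have "{i. i < n \<and> w' $ i \<noteq> 0} \<subseteq> {i. i < n \<and> w $ i \<noteq> 0}"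
        using w'_index by fastforce
      moreover have "w' $ j = 0" using w'_index[OF j(1)] by simp
      ultimately have "{i. i < n \<and> w' $ i \<noteq> 0} \<subset> {i. i < n \<and> w $ i \<noteq> 0}"
        using j by blast
      thus "card {i. i < n \<and> w' $ i \<noteq> 0} < card {i. i < n \<and> w $ i \<noteq> 0}"
        by (intro psubset_card_mono) auto
    qed
  next
    case False
    hence "unit_vec n k = inverse (w $ k) \<cdot>\<^sub>v w"
      using w less.prems assms(3) by (auto simp: vec_eq_iff)
    thus ?thesis using W less.prems by simp
  qed
qed

text \<open>If \<open>e\<^sub>i\<close> lies in a submodule and \<open>M g\<close> has a nonzero entry at \<open>(k, i)\<close>, then \<open>M g e\<^sub>i\<close> has a
  nonzero coordinate at \<open>k\<close>, so \<open>e\<^sub>k\<close> lies in the submodule too. The assumptions make every index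
  reachable from every other one along such links.\<close>

lemma irreducible:
  assumes up: "\<And>k. Suc k < n \<Longrightarrow> \<exists>g. M g $$ (Suc k, k) \<noteq> 0"
    and down: "\<And>k. Suc k < n \<Longrightarrow> \<exists>g. M g $$ (k, Suc k) \<noteq> 0"
  shows "irreducible_module r0 r1 V (matrix_action n M)"
  unfolding irreducible_module_def
proof (rule notI, elim exE conjE)
  fix W
  assume W: "Ht_submodule r0 r1 V (matrix_action n M) W" and nz: "W \<noteq> {\<zero>\<^bsub>V\<^esub>}" and ne: "W \<noteq> carrier V"
  hence sub: "submodule class_ring W V" unfolding Ht_submodule_def subspace_def by blast
  hence carr: "W \<subseteq> carrier_vec n" and zero: "0\<^sub>v n \<in> W" unfolding submodule_def by auto
  have link: "unit_vec n k \<in> W" if "unit_vec n i \<in> W" "i < n" "k < n" "M g $$ (k, i) \<noteq> 0" for i k g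
  proof (rule unit_vec_mem_submodule[OF W])
    show "M g *\<^sub>v unit_vec n i \<in> W"
      using W that(1) unfolding Ht_submodule_def matrix_action_gen[symmetric] by (simp add: Ht_gen_def)
    show "(M g *\<^sub>v unit_vec n i) $ k \<noteq> 0"
      using that carrier_matD[OF M[of g]] by simp
  qed (rule that)
  obtain w where w: "w \<in> W" "w \<noteq> 0\<^sub>v n" using nz zero by auto
  then obtain k where k: "k < n" "w $ k \<noteq> 0" using carr by (auto simp: vec_eq_iff)
  hence base: "unit_vec n k \<in> W" using unit_vec_mem_submodule[OF W w(1)] by blast
  have "unit_vec n j \<in> W" if "j < n" for j
  proof (cases "k \<le> j")
    case True
    thus ?thesis using that
    proof (induction j rule: dec_induct)
      case (step j)
      thus ?case using up[of j] link[of j "Suc j"] by auto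
    qed (rule base)
  next
    case False
    hence "j \<le> k" by simp
    thus ?thesis
    proof (induction rule: inc_induct)
      case (step j)
      thus ?case using down[of j] link[of "Suc j" j] k(1) by auto
    qed (rule base)
  qed
  hence "set (unit_vecs n) \<subseteq> W" by (auto simp: unit_vecs_def)
  hence "span (set (unit_vecs n)) \<subseteq> W" by (rule span_is_subset[OF _ sub])
  thus False using ne carr by (simp add: span_unit_vecs_is_carrier)
qed

end

section \<open>The two block decompositions of the module\<close>

text \<open>Writing the list of blocks as a family indexed by \<open>[0..<Suc D]\<close> lets products of such matrices be
  computed by \<open>diag_block_mat_mult\<close>, which multiplies two families over the same index list.\<close>

definition pairs_then_point :: "nat \<Rightarrow> (nat \<Rightarrow> complex mat) \<Rightarrow> complex \<Rightarrow> complex mat" where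
  "pairs_then_point D F x = diag_block_mat (map (\<lambda>i. if i < D then F i else scalar_mat x) [0..<Suc D])"

definition point_then_pairs :: "nat \<Rightarrow> complex \<Rightarrow> (nat \<Rightarrow> complex mat) \<Rightarrow> complex mat" where
  "point_then_pairs D x F = diag_block_mat (map (case_nat (scalar_mat x) F) [0..<Suc D])"

lemma pairs_then_point_eq:
  "pairs_then_point D F x = diag_block_mat (map F [0..<D] @ [scalar_mat x])"
proof -
  have "map (\<lambda>i. if i < D then F i else scalar_mat x) [0..<D] = map F [0..<D]" by simp
  thus ?thesis unfolding pairs_then_point_def by (simp del: map_eq_conv)
qed

lemma point_then_pairs_eq:
  "point_then_pairs D x F = diag_block_mat (scalar_mat x # map F [0..<D])"
proof -
  have "map (case_nat (scalar_mat x) F) [0..<Suc D] = scalar_mat x # map F [0..<D]"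
    by (simp add: upt_conv_Cons map_Suc_upt[symmetric] o_def del: upt_Suc)
  thus ?thesis unfolding point_then_pairs_def by simp
qed

lemma scalar_mat_carrier [simp]: "scalar_mat x \<in> carrier_mat 1 1"
  by (simp add: scalar_mat_def mat_of_rows_list_def)

lemma scalar_mat_index [simp]: "scalar_mat x $$ (0, 0) = x"
  by (simp add: scalar_mat_def mat_of_rows_list_def)

lemma scalar_mat_dim [simp]: "dim_row (scalar_mat x) = 1" "dim_col (scalar_mat x) = 1"
  by (simp_all add: scalar_mat_def mat_of_rows_list_def)

lemma scalar_mat_mult [simp]: "scalar_mat x * scalar_mat y = scalar_mat (x * y)"
  by (rule eq_matI) (auto simp: scalar_prod_def)

lemma scalar_mat_minus [simp]: "scalar_mat x - z \<cdot>\<^sub>m 1\<^sub>m (Suc 0) = scalar_mat (x - z)"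
  by (rule eq_matI) auto

lemma scalar_mat_zero [simp]: "scalar_mat 0 = 0\<^sub>m 1 1"
  by (rule eq_matI) auto

context
  fixes F :: "nat \<Rightarrow> complex mat"
  assumes F: "F i \<in> carrier_mat 2 2"
begin

lemma block_dim [simp]: "dim_row (F i) = 2" "dim_col (F i) = 2"
  using F by auto

lemma pairs_then_point_rows:
  "i \<le> D \<Longrightarrow> sum_list (map dim_row (take i (map F [0..<D] @ [scalar_mat x]))) = 2 * i"
  by (simp add: take_map o_def sum_list_triv)

lemma point_then_pairs_rows:
  "i \<le> D \<Longrightarrow> sum_list (map dim_row (take (Suc i) (scalar_mat x # map F [0..<D]))) = 2 * i + 1"
  by (simp add: take_map o_def sum_list_triv)

lemma blocks_square:
  "\<forall>A \<in> set (map F [0..<D] @ [scalar_mat x]). square_mat A"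
  "\<forall>A \<in> set (scalar_mat x # map F [0..<D]). square_mat A"
  by auto

lemma pairs_then_point_carrier: "pairs_then_point D F x \<in> carrier_mat (2 * D + 1) (2 * D + 1)"
  using diag_block_mat_carrier[OF blocks_square(1)]
  by (simp add: pairs_then_point_eq o_def sum_list_triv mult.commute)

lemma point_then_pairs_carrier: "point_then_pairs D x F \<in> carrier_mat (2 * D + 1) (2 * D + 1)"
  using diag_block_mat_carrier[OF blocks_square(2)]
  by (simp add: point_then_pairs_eq o_def sum_list_triv mult.commute)

lemma pairs_then_point_index:
  assumes "i < D" "p < 2" "q < 2"
  shows "pairs_then_point D F x $$ (2 * i + p, 2 * i + q) = F i $$ (p, q)"
  using diag_block_mat_index[OF blocks_square(1), of i D x p q] pairs_then_point_rows[of i D x] assms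
  by (simp add: pairs_then_point_eq nth_append)

lemma pairs_then_point_last: "pairs_then_point D F x $$ (2 * D, 2 * D) = x"
  using diag_block_mat_index[OF blocks_square(1), of D D x 0 0] pairs_then_point_rows[of D D x]
  by (simp add: pairs_then_point_eq nth_append)

lemma point_then_pairs_index:
  assumes "i < D" "p < 2" "q < 2"
  shows "point_then_pairs D x F $$ (2 * i + 1 + p, 2 * i + 1 + q) = F i $$ (p, q)"
  using diag_block_mat_index[OF blocks_square(2), of "Suc i" x D p q] point_then_pairs_rows[of i D x] assms
  by (simp add: point_then_pairs_eq)

lemma point_then_pairs_first: "point_then_pairs D x F $$ (0, 0) = x"
  using diag_block_mat_index[OF blocks_square(2), of 0 x D 0 0]
  by (simp add: point_then_pairs_eq)

lemma pairs_then_point_minus: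
  "pairs_then_point D F x - z \<cdot>\<^sub>m 1\<^sub>m (2 * D + 1) = pairs_then_point D (\<lambda>i. F i - z \<cdot>\<^sub>m 1\<^sub>m 2) (x - z)"
  using diag_block_mat_minus_scalar[OF blocks_square(1), of D x z]
  by (simp add: pairs_then_point_eq o_def sum_list_triv mult.commute)

lemma point_then_pairs_minus:
  "point_then_pairs D x F - z \<cdot>\<^sub>m 1\<^sub>m (2 * D + 1) = point_then_pairs D (x - z) (\<lambda>i. F i - z \<cdot>\<^sub>m 1\<^sub>m 2)"
  using diag_block_mat_minus_scalar[OF blocks_square(2), of x D z]
  by (simp add: point_then_pairs_eq o_def sum_list_triv mult.commute)

lemma pairs_then_point_mult:
  assumes "\<And>i. G i \<in> carrier_mat 2 2"
  shows "pairs_then_point D F x * pairs_then_point D G y = pairs_then_point D (\<lambda>i. F i * G i) (x * y)"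
  unfolding pairs_then_point_def
  by (subst diag_block_mat_mult)
    (use F assms scalar_mat_carrier in \<open>auto simp del: upt_Suc intro!: arg_cong[of _ _ diag_block_mat]\<close>)

lemma point_then_pairs_mult:
  assumes "\<And>i. G i \<in> carrier_mat 2 2"
  shows "point_then_pairs D x F * point_then_pairs D y G = point_then_pairs D (x * y) (\<lambda>i. F i * G i)"
  unfolding point_then_pairs_def
  by (subst diag_block_mat_mult)
    (use F assms scalar_mat_carrier in \<open>auto simp del: upt_Suc intro!: arg_cong[of _ _ diag_block_mat] split: nat.split\<close>)

end

lemma pairs_then_point_cong:
  "(\<And>i. i < D \<Longrightarrow> F i = G i) \<Longrightarrow> pairs_then_point D F x = pairs_then_point D G x"
  unfolding pairs_then_point_def by (intro arg_cong[of _ _ diag_block_mat] map_cong) auto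

lemma point_then_pairs_cong:
  "(\<And>i. i < D \<Longrightarrow> F i = G i) \<Longrightarrow> point_then_pairs D x F = point_then_pairs D x G"
  unfolding point_then_pairs_def
  by (intro arg_cong[of _ _ diag_block_mat] map_cong) (auto split: nat.split simp del: upt_Suc)

lemma pairs_then_point_zero:
  assumes "\<forall>i<D. F i = 0\<^sub>m 2 2"
  shows "pairs_then_point D F 0 = 0\<^sub>m (2 * D + 1) (2 * D + 1)"
proof -
  have *: "map F [0..<D] = map (\<lambda>_. 0\<^sub>m 2 2) [0..<D]" using assms by simp
  thus ?thesis unfolding pairs_then_point_eq *
    by (subst diag_block_mat_zero) (auto simp: o_def sum_list_triv mult.commute)
qed

lemma point_then_pairs_zero:
  assumes "\<forall>i<D. F i = 0\<^sub>m 2 2"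
  shows "point_then_pairs D 0 F = 0\<^sub>m (2 * D + 1) (2 * D + 1)"
proof -
  have *: "map F [0..<D] = map (\<lambda>_. 0\<^sub>m 2 2) [0..<D]" using assms by simp
  thus ?thesis unfolding point_then_pairs_eq *
    by (subst diag_block_mat_zero) (auto simp: o_def sum_list_triv mult.commute)
qed

text \<open>Both \<open>A\<close> and \<open>B\<close> consist of blocks of this shape: each weight sits on the first basis vector of its
  pair.\<close>

definition unit_block :: "complex \<Rightarrow> complex mat" where
  "unit_block z = mat_of_rows_list 2 [[z, 0], [0, 0]]"

lemma unit_block_carrier: "unit_block z \<in> carrier_mat 2 2"
  by (rule carrier_matI) (simp_all add: unit_block_def mat_of_rows_list_def)

lemma unit_block_index: "i < 2 \<Longrightarrow> j < 2 \<Longrightarrow> unit_block z $$ (i, j) = (if i = 0 \<and> j = 0 then z else 0)"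
  by (auto simp: unit_block_def mat_of_rows_list_def less_2_cases_iff)

lemma unit_block_diagonal: "diagonal_mat (unit_block z)"
  unfolding diagonal_mat_def using unit_block_carrier[of z] by (auto simp: unit_block_index)

lemma diag_mat_eq_mat_diag:
  assumes "A \<in> carrier_mat n n" "diagonal_mat A" "\<And>i. i < n \<Longrightarrow> A $$ (i, i) = f i"
  shows "A = mat_diag n f"
  using assms by (intro eq_matI) (auto simp: mat_diag_def diagonal_mat_def)

lemma pairs_then_point_unit_blocks:
  "pairs_then_point D (\<lambda>i. unit_block (d i)) x =
    mat_diag (2 * D + 1) (\<lambda>j. if j = 2 * D then x else if even j then d (j div 2) else 0)"
proof (rule diag_mat_eq_mat_diag)
  show "diagonal_mat (pairs_then_point D (\<lambda>i. unit_block (d i)) x)"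
    unfolding pairs_then_point_eq
    by (rule diag_block_mat_diagonal)
      (use carrier_matD[OF unit_block_carrier] unit_block_diagonal in \<open>auto simp: diagonal_mat_def[of "scalar_mat x"]\<close>)
  fix j assume "j < 2 * D + 1"
  then consider "j = 2 * D" | "j div 2 < D" "j \<noteq> 2 * D" by linarith
  thus "pairs_then_point D (\<lambda>i. unit_block (d i)) x $$ (j, j) =
      (if j = 2 * D then x else if even j then d (j div 2) else 0)"
  proof cases
    case 2
    thus ?thesis
      using pairs_then_point_index[of "\<lambda>i. unit_block (d i)" "j div 2" D "j mod 2" "j mod 2" x]
      by (auto simp: unit_block_carrier unit_block_index even_iff_mod_2_eq_zero)
  qed (simp add: pairs_then_point_last unit_block_carrier)
qed (rule pairs_then_point_carrier[OF unit_block_carrier])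

lemma point_then_pairs_unit_blocks:
  "point_then_pairs D 0 (\<lambda>i. unit_block (d i)) =
    mat_diag (2 * D + 1) (\<lambda>j. if odd j then d (j div 2) else 0)"
proof (rule diag_mat_eq_mat_diag)
  show "diagonal_mat (point_then_pairs D 0 (\<lambda>i. unit_block (d i)))"
    unfolding point_then_pairs_eq
    by (rule diag_block_mat_diagonal)
      (use carrier_matD[OF unit_block_carrier] unit_block_diagonal in \<open>auto simp: diagonal_mat_def[of "0\<^sub>m _ _"]\<close>)
  fix j assume "j < 2 * D + 1"
  moreover have "j = 2 * ((j - 1) div 2) + 1 + (j - 1) mod 2" if "j \<noteq> 0" using that by presburger
  ultimately consider "j = 0" | i p where "j = 2 * i + 1 + p" "i < D" "p < 2"
    by (cases "j = 0") (auto intro!: that(2)[of "(j - 1) div 2" "(j - 1) mod 2"])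
  thus "point_then_pairs D 0 (\<lambda>i. unit_block (d i)) $$ (j, j) = (if odd j then d (j div 2) else 0)"
  proof cases
    case 2
    thus ?thesis
      using point_then_pairs_index[of "\<lambda>i. unit_block (d i)" i D p p 0]
      by (auto simp: unit_block_carrier unit_block_index less_2_cases_iff)
  qed (simp add: point_then_pairs_first unit_block_carrier)
qed (rule point_then_pairs_carrier[OF unit_block_carrier])

section \<open>The blocks\<close>

lemma eq_mat2I:
  assumes "A \<in> carrier_mat 2 2" "B \<in> carrier_mat 2 2"
    and "A $$ (0, 0) = B $$ (0, 0)" "A $$ (0, 1) = B $$ (0, 1)"
    and "A $$ (1, 0) = B $$ (1, 0)" "A $$ (1, 1) = B $$ (1, 1)"
  shows "A = B"
  using assms by (intro eq_matI) (auto simp: less_2_cases_iff)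

lemma mat_of_rows_list_2_mult:
  "mat_of_rows_list 2 [[a, b], [c, d]] * mat_of_rows_list 2 [[a', b'], [c', d']] =
    mat_of_rows_list 2 [[a * a' + b * c', a * b' + b * d'], [c * a' + d * c', c * b' + d * d' :: complex]]"
  by (rule eq_mat2I) (auto simp: mat_of_rows_list_def scalar_prod_def numeral_2_eq_2)

lemma mat_of_rows_list_2_minus:
  "mat_of_rows_list 2 [[a, b], [c, d]] - z \<cdot>\<^sub>m 1\<^sub>m 2 =
    mat_of_rows_list 2 [[a - z, b], [c, d - z :: complex]]"
  by (rule eq_mat2I) (auto simp: mat_of_rows_list_def)

lemma mat_of_rows_list_2_zero: "0\<^sub>m 2 2 = mat_of_rows_list 2 [[0, 0], [0, 0 :: complex]]"
  by (rule eq_mat2I) (auto simp: mat_of_rows_list_def)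

lemma block_carrier [simp]:
  "R_mat r z c \<in> carrier_mat 2 2" "P_mat c \<in> carrier_mat 2 2"
  "S_mat r s \<in> carrier_mat 2 2" "N_mat s z \<in> carrier_mat 2 2"
  by (rule carrier_matI; simp add: R_mat_def P_mat_def S_mat_def N_mat_def mat_of_rows_list_def)+

lemmas block_defs = R_mat_def P_mat_def S_mat_def N_mat_def k_sum_def unit_block_def
  mat_of_rows_list_2_mult mat_of_rows_list_2_minus mat_of_rows_list_2_zero

text \<open>The matrix has trace \<open>r + r\<^sup>-\<^sup>1\<close> and determinant \<open>1\<close>, so this is its Cayley-Hamilton equation; the
  same holds for \<^const>\<open>S_mat\<close>.\<close>

lemma R_mat_quadratic:
  assumes "r \<noteq> 0" "z \<noteq> 0" "c \<noteq> 0"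
  shows "(R_mat r z c - r \<cdot>\<^sub>m 1\<^sub>m 2) * (R_mat r z c - inverse r \<cdot>\<^sub>m 1\<^sub>m 2) = 0\<^sub>m 2 2"
  unfolding block_defs using assms by (simp add: field_simps)

lemma S_mat_quadratic:
  assumes "r \<noteq> 0" "s \<noteq> 0"
  shows "(S_mat r s - r \<cdot>\<^sub>m 1\<^sub>m 2) * (S_mat r s - inverse r \<cdot>\<^sub>m 1\<^sub>m 2) = 0\<^sub>m 2 2"
  unfolding block_defs using assms by (simp add: field_simps)

lemma P_mat_idem: "P_mat c * P_mat c = P_mat c"
  unfolding block_defs by simp

lemma N_mat_square: "N_mat s z * N_mat s z = 0\<^sub>m 2 2"
  unfolding block_defs by simp

lemma P_R_mat:
  assumes "z \<noteq> 0" "c \<noteq> 0"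
  shows "P_mat c * R_mat r z c = unit_block z"
  unfolding block_defs using assms by (simp add: field_simps)

lemma S_N_mat:
  assumes "s \<noteq> 0"
  shows "S_mat r s * N_mat s z = unit_block z"
  unfolding block_defs using assms by (simp add: field_simps)

text \<open>This is where \<open>\<lambda>\<^sub>i \<noteq> r\<^sub>0, r\<^sub>0\<^sup>-\<^sup>1\<close> enters the irreducibility.\<close>

lemma R_mat_lower_nonzero:
  assumes "z \<noteq> 0" "c \<noteq> 0" "r \<noteq> 0" "z \<notin> {r, inverse r}"
  shows "R_mat r z c $$ (1, 0) \<noteq> 0"
proof -
  have "z - k_sum r + inverse z = (z - r) * (z - inverse r) / z"
    using assms by (simp add: k_sum_def field_simps)
  moreover have "R_mat r z c $$ (1, 0) = inverse c * (z - k_sum r + inverse z)"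
    by (simp add: R_mat_def mat_of_rows_list_def)
  ultimately show ?thesis using assms by simp
qed

lemma R_mat_upper_nonzero: "z \<noteq> 0 \<Longrightarrow> c \<noteq> 0 \<Longrightarrow> R_mat r z c $$ (0, 1) \<noteq> 0"
  by (simp add: R_mat_def mat_of_rows_list_def)

lemma S_mat_off_diagonal:
  "s \<noteq> 0 \<Longrightarrow> S_mat r s $$ (0, 1) \<noteq> 0" "s \<noteq> 0 \<Longrightarrow> S_mat r s $$ (1, 0) \<noteq> 0"
  by (simp_all add: S_mat_def mat_of_rows_list_def)


section \<open>The module\<close>

lemma O_mat_blocks:
  "O_mat r0 r1 D \<rho> \<sigma> c s l m T0 = pairs_then_point D (\<lambda>i. R_mat r0 (l i) (c i)) \<rho>"
  "O_mat r0 r1 D \<rho> \<sigma> c s l m U0 = pairs_then_point D (\<lambda>i. P_mat (c i)) 1"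
  "O_mat r0 r1 D \<rho> \<sigma> c s l m T1 = point_then_pairs D \<sigma> (\<lambda>i. S_mat r1 (s i))"
  "O_mat r0 r1 D \<rho> \<sigma> c s l m U1 = point_then_pairs D 0 (\<lambda>i. N_mat (s i) (m i))"
  by (simp_all only: O_mat.simps pairs_then_point_eq point_then_pairs_eq)

theorem theorem3p8:
  fixes D :: nat and r0 r1 \<rho> \<sigma> :: complex
    and c s l m :: "nat \<Rightarrow> complex"
  assumes "r0 \<noteq> 0" and "r1 \<noteq> 0"
    and "\<rho> \<in> {r0, inverse r0}" and "\<sigma> \<in> {r1, inverse r1}"
    and "\<forall>i<D. c i \<noteq> 0 \<and> s i \<noteq> 0 \<and> l i \<noteq> 0 \<and> m i \<noteq> 0"
    and "inj_on l {..<D}"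
    and "\<forall>i<D. l i \<notin> {r0, inverse r0}"
    and "inj_on m {..<D}"
  shows "fd_Ht_module (O_space D) r0 r1 (O_act r0 r1 D \<rho> \<sigma> c s l m) \<and>
    multiplicity_free r0 r1 (O_space D) (O_act r0 r1 D \<rho> \<sigma> c s l m) \<and>
    irreducible_module r0 r1 (O_space D) (O_act r0 r1 D \<rho> \<sigma> c s l m)"
proof -
  define n where "n = 2 * D + 1"
  define M where "M = O_mat r0 r1 D \<rho> \<sigma> c s l m"
  \<comment> \<open>The vector \<open>a\<^sub>i\<close> has index \<open>2 i\<close> and \<open>b\<^sub>i\<close> has index \<open>2 i + 1\<close>, so \<open>\<alpha>\<close> and \<open>\<beta>\<close> are the
    eigenvalues of \<open>A\<close> and \<open>B\<close> in the basis order.\<close>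
  define \<alpha> where "\<alpha> = (\<lambda>j. if j = 2 * D then \<rho> else if even j then l (j div 2) else 0)"
  define \<beta> where "\<beta> = (\<lambda>j::nat. if odd j then m (j div 2) else 0)"
  note M_blocks = O_mat_blocks[of r0 r1 D \<rho> \<sigma> c s l m, folded M_def]
  have A: "M U0 * M T0 = mat_diag n \<alpha>"
  proof -
    have "M U0 * M T0 = pairs_then_point D (\<lambda>i. P_mat (c i) * R_mat r0 (l i) (c i)) \<rho>"
      unfolding M_blocks by (simp add: pairs_then_point_mult)
    also have "\<dots> = pairs_then_point D (\<lambda>i. unit_block (l i)) \<rho>"
      using assms(5) by (intro pairs_then_point_cong) (simp add: P_R_mat)
    also have "\<dots> = mat_diag n \<alpha>"
      unfolding n_def \<alpha>_def by (rule pairs_then_point_unit_blocks)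
    finally show ?thesis .
  qed
  have B: "M T1 * M U1 = mat_diag n \<beta>"
  proof -
    have "M T1 * M U1 = point_then_pairs D 0 (\<lambda>i. S_mat r1 (s i) * N_mat (s i) (m i))"
      unfolding M_blocks by (simp add: point_then_pairs_mult)
    also have "\<dots> = point_then_pairs D 0 (\<lambda>i. unit_block (m i))"
      using assms(5) by (intro point_then_pairs_cong) (simp add: S_N_mat)
    also have "\<dots> = mat_diag n \<beta>"
      unfolding n_def \<beta>_def by (rule point_then_pairs_unit_blocks)
    finally show ?thesis .
  qed
  have \<rho>: "(\<rho> - r0) * (\<rho> - inverse r0) = 0" and \<sigma>: "(\<sigma> - r1) * (\<sigma> - inverse r1) = 0"
    using assms(3,4) by auto
  have orth: "\<alpha> j * \<beta> j = 0" for j by (auto simp: \<alpha>_def \<beta>_def)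
  have zero_diag: "mat_diag n (\<lambda>j. 0) = (0\<^sub>m n n :: complex mat)"
    by (rule eq_matI) (auto simp: mat_diag_def)
  interpret weight_matrices n M r0 r1 \<alpha> \<beta>
  proof
    show "M g \<in> carrier_mat n n" for g
      unfolding n_def by (cases g) (simp_all only: M_blocks block_carrier pairs_then_point_carrier point_then_pairs_carrier)
    show "(M T0 - r0 \<cdot>\<^sub>m 1\<^sub>m n) * (M T0 - inverse r0 \<cdot>\<^sub>m 1\<^sub>m n) = 0\<^sub>m n n"
      unfolding M_blocks n_def using assms(1,5)
      by (simp only: pairs_then_point_minus block_carrier)
        (simp add: pairs_then_point_mult pairs_then_point_zero R_mat_quadratic \<rho> minus_carrier_mat)
    show "(M T1 - r1 \<cdot>\<^sub>m 1\<^sub>m n) * (M T1 - inverse r1 \<cdot>\<^sub>m 1\<^sub>m n) = 0\<^sub>m n n"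
      unfolding M_blocks n_def using assms(2,5)
      by (simp only: point_then_pairs_minus block_carrier)
        (simp add: point_then_pairs_mult point_then_pairs_zero S_mat_quadratic \<sigma> minus_carrier_mat)
    show "M U0 * M U0 = M U0"
      unfolding M_blocks by (simp add: pairs_then_point_mult P_mat_idem)
    show "M U1 * M U1 = 0\<^sub>m n n"
      unfolding M_blocks n_def by (simp add: point_then_pairs_mult N_mat_square point_then_pairs_zero)
    show "M U0 * M T0 = mat_diag n \<alpha>" "M T1 * M U1 = mat_diag n \<beta>" by (fact A B)+
    show "M U0 * M T0 * (M T1 * M U1) = 0\<^sub>m n n" "M T1 * M U1 * (M U0 * M T0) = 0\<^sub>m n n"
      unfolding A B by (simp_all add: orth mult.commute[of "\<beta> _"] zero_diag)
    show "inj_on (\<lambda>j. (\<alpha> j, \<beta> j)) {..<n}"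
    proof (rule inj_onI)
      fix i j assume ij: "i \<in> {..<n}" "j \<in> {..<n}" "(\<alpha> i, \<beta> i) = (\<alpha> j, \<beta> j)"
      \<comment> \<open>Nonvanishing of the \<open>m\<close> separates odd from even indices; within the even ones, the last
        index is separated by \<open>\<rho>\<close> not being among the \<open>l\<close>.\<close>
      have m: "m (k div 2) \<noteq> 0" if "k < n" "odd k" for k
        using assms(5) that unfolding n_def by (auto elim!: oddE)
      have l: "l (k div 2) \<noteq> \<rho>" if "k < n" "even k" "k \<noteq> 2 * D" for k
      proof -
        have "k div 2 < D" using that unfolding n_def by (auto elim!: evenE)
        thus ?thesis using assms(3,7) by blast
      qed
      show "i = j"
      proof (cases "odd i")
        case True
        hence "odd j" "m (i div 2) = m (j div 2)" using ij m[of i] by (auto simp: \<beta>_def split: if_splits)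
        moreover have "i div 2 < D" "j div 2 < D" using ij \<open>odd i\<close> \<open>odd j\<close> unfolding n_def by (auto elim!: oddE)
        ultimately have "i div 2 = j div 2" using inj_onD[OF assms(8)] by simp
        thus ?thesis using \<open>odd i\<close> \<open>odd j\<close> by (metis odd_two_times_div_two_succ)
      next
        case False
        hence "even j" using ij m[of j] by (auto simp: \<beta>_def split: if_splits)
        show ?thesis
        proof (cases "i = 2 * D \<or> j = 2 * D")
          case True
          thus ?thesis using ij l[of i] l[of j] \<open>even j\<close> False by (auto simp: \<alpha>_def split: if_splits)
        next
          case not_last: False
          hence "l (i div 2) = l (j div 2)" using ij \<open>even j\<close> False by (auto simp: \<alpha>_def)
          moreover have "i div 2 < D" "j div 2 < D" using ij not_last unfolding n_def by auto
          ultimately have "i div 2 = j div 2" using inj_onD[OF assms(6)] by simp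
          thus ?thesis using \<open>even j\<close> False by (metis even_two_times_div_two)
        qed
      qed
    qed
  qed
  have adjacent: "(\<exists>g. M g $$ (Suc k, k) \<noteq> 0) \<and> (\<exists>g. M g $$ (k, Suc k) \<noteq> 0)" if "Suc k < n" for k
  proof (cases "even k")
    case True
    then obtain i where i: "k = 2 * i" by (rule evenE)
    hence "i < D" using that by (simp add: n_def)
    hence "M T0 $$ (Suc k, k) \<noteq> 0 \<and> M T0 $$ (k, Suc k) \<noteq> 0"
      using pairs_then_point_index[OF block_carrier(1), of i D 1 0]
        pairs_then_point_index[OF block_carrier(1), of i D 0 1]
        R_mat_lower_nonzero[of "l i" "c i" r0] R_mat_upper_nonzero[of "l i" "c i" r0] assms(1,5,7)
      unfolding M_blocks i by simp
    thus ?thesis by blast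
  next
    case False
    then obtain i where i: "k = 2 * i + 1" by (rule oddE)
    hence "i < D" using that by (simp add: n_def)
    hence "M T1 $$ (Suc k, k) \<noteq> 0 \<and> M T1 $$ (k, Suc k) \<noteq> 0"
      using point_then_pairs_index[OF block_carrier(3), of i D 1 0]
        point_then_pairs_index[OF block_carrier(3), of i D 0 1]
        S_mat_off_diagonal[of "s i" r1] assms(5)
      unfolding M_blocks i by simp
    thus ?thesis by blast
  qed
  have "O_space D = V" "O_act r0 r1 D \<rho> \<sigma> c s l m = matrix_action n M"
    by (simp_all add: O_space_def O_act_def n_def M_def)
  thus ?thesis using fd_Ht_module multiplicity_free irreducible adjacent by simp
qed

end
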